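(* Let $R$ be an integral domain, $L_n=R[t_1^{\pm1},\dots,t_n^{\pm1}]=R[\mathbb{Z}^n]$, and $C_*$ a finite free chain complex over $L_n$. Let $k\ge0$ and $q>0$. Then there is a finite family of proper full subgroups $G_i\subset\mathrm{Hom}(\mathbb{Z}^n,\mathbb{Z})$ such that for every $m$ and every homomorphism $p\in\mathrm{Hom}(\mathbb{Z}^n,\mathbb{Z}^m)$ the condition $b_k(C_*,p)\ge b_k(C_* )+q$ is equivalent to: $p\sqsubset G_i$ for some $i$.
   Context: $b_k(C_* )$ is the dimension over the fraction field of $L_n$ of $H_k(C_*\otimes_{L_n}\{L_n\})$. A group homomorphism $p:\mathbb{Z}^n\to\mathbb{Z}^m$ extends to a ring homomorphism $p:L_n\to L_m=R[\mathbb{Z}^m]$; $\mathcal{Q}_m$ denotes the fraction field of $L_m$ and $b_k(C_*,p)=\dim_{\mathcal{Q}_m}H_k(C_*\otimes_p\mathcal{Q}_m)$. A subgroup of $\mathbb{Z}^n$ (or of $\mathrm{Hom}(\mathbb{Z}^n,\mathbb{Z})$) is full if it is a direct summand. For a full subgroup $G\subset\mathrm{Hom}(\mathbb{Z}^n,\mathbb{Z})$, write $p\sqsubset G$ if all coordinates $p_j\in\mathrm{Hom}(\mathbb{Z}^n,\mathbb{Z})$ of $p$ belong to $G$. *)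

theory Defs
  imports "HOL-Library.Poly_Mapping" "HOL-Computational_Algebra.Fraction_Field"
    "Jordan_Normal_Form.Matrix_Kernel" "Jordan_Normal_Form.DL_Rank"
begin

text \<open>Group ring R[Z^(omega)] of the free abelian group of finitely supported
  integer vectors; L_n is the subring of elements involving only t_0,...,t_(n-1).
  It is an integral domain when R is (library instance).\<close>
type_synonym 'a laurent = "(nat \<Rightarrow>\<^sub>0 int) \<Rightarrow>\<^sub>0 'a"

definition in_L :: "nat \<Rightarrow> 'a::zero laurent \<Rightarrow> bool" where
  "in_L n f \<longleftrightarrow> (\<forall>a \<in> Poly_Mapping.keys f. \<forall>i. n \<le> i \<longrightarrow> Poly_Mapping.lookup a i = 0)"

text \<open>A homomorphism p : Z^n -> Z^m is an integer matrix P (entries P i j, i<m, j<n);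
  its action on exponent vectors, and its extension to a ring map L_n -> L_m.\<close>
definition hom_exp :: "(nat \<Rightarrow> nat \<Rightarrow> int) \<Rightarrow> nat \<Rightarrow> nat \<Rightarrow> (nat \<Rightarrow>\<^sub>0 int) \<Rightarrow> (nat \<Rightarrow>\<^sub>0 int)" where
  "hom_exp P n m a = Abs_poly_mapping (\<lambda>i. if i < m then (\<Sum>j<n. P i j * Poly_Mapping.lookup a j) else 0)"

definition hom_ring :: "(nat \<Rightarrow> nat \<Rightarrow> int) \<Rightarrow> nat \<Rightarrow> nat \<Rightarrow> 'a::comm_ring_1 laurent \<Rightarrow> 'a laurent" where
  "hom_ring P n m f = (\<Sum>a \<in> Poly_Mapping.keys f. Poly_Mapping.single (hom_exp P n m a) (Poly_Mapping.lookup f a))"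

text \<open>Finite free chain complex over L_n, graded by N: C_j = L_n^(c j), zero for large j,
  boundary d j : C_j -> C_(j-1) (j >= 1) given by a (c (j-1)) x (c j) matrix; d_0 = 0.\<close>
definition fin_free_complex :: "nat \<Rightarrow> (nat \<Rightarrow> nat) \<Rightarrow> (nat \<Rightarrow> 'a::comm_ring_1 laurent mat) \<Rightarrow> bool" where
  "fin_free_complex n c d \<longleftrightarrow>
     (\<exists>N. \<forall>j\<ge>N. c j = 0) \<and>
     (\<forall>j\<ge>1. d j \<in> carrier_mat (c (j - 1)) (c j)) \<and>
     (\<forall>j\<ge>1. \<forall>i<c (j - 1). \<forall>l<c j. in_L n (d j $$ (i, l))) \<and>
     (\<forall>j\<ge>1. d j * d (j + 1) = 0\<^sub>m (c (j - 1)) (c (j + 1)))"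

definition bdry :: "(nat \<Rightarrow> nat) \<Rightarrow> (nat \<Rightarrow> 'a::zero mat) \<Rightarrow> nat \<Rightarrow> 'a mat" where
  "bdry c d j = (if j = 0 then 0\<^sub>m 0 (c 0) else d j)"

definition hdim :: "(nat \<Rightarrow> nat) \<Rightarrow> (nat \<Rightarrow> 'k::field mat) \<Rightarrow> nat \<Rightarrow> nat" where
  "hdim c D k = kernel_dim (D k) - vec_space.rank (c k) (D (k + 1))"

definition betti_p :: "nat \<Rightarrow> (nat \<Rightarrow> nat) \<Rightarrow> (nat \<Rightarrow> 'a::idom laurent mat) \<Rightarrow> nat
     \<Rightarrow> nat \<Rightarrow> (nat \<Rightarrow> nat \<Rightarrow> int) \<Rightarrow> nat" where
  "betti_p n c d k m P =
     hdim c (\<lambda>j. map_mat (\<lambda>f. Fract (hom_ring P n m f) 1) (bdry c d j)) k"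

definition betti :: "(nat \<Rightarrow> nat) \<Rightarrow> (nat \<Rightarrow> 'a::idom laurent mat) \<Rightarrow> nat \<Rightarrow> nat" where
  "betti c d k = hdim c (\<lambda>j. map_mat (\<lambda>f. Fract f 1) (bdry c d j)) k"

text \<open>Hom(Z^n,Z) = Z^n, represented by integer vectors vanishing from index n on.\<close>
definition Zn :: "nat \<Rightarrow> (nat \<Rightarrow> int) set" where
  "Zn n = {v. \<forall>i\<ge>n. v i = 0}"

definition subgroup_Zn :: "nat \<Rightarrow> (nat \<Rightarrow> int) set \<Rightarrow> bool" where
  "subgroup_Zn n G \<longleftrightarrow> G \<subseteq> Zn n \<and> (\<lambda>_. 0) \<in> G \<and>
     (\<forall>x\<in>G. \<forall>y\<in>G. (\<lambda>i. x i + y i) \<in> G) \<and> (\<forall>x\<in>G. (\<lambda>i. - x i) \<in> G)"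

definition full_subgroup :: "nat \<Rightarrow> (nat \<Rightarrow> int) set \<Rightarrow> bool" where
  "full_subgroup n G \<longleftrightarrow> subgroup_Zn n G \<and>
     (\<exists>H. subgroup_Zn n H \<and> G \<inter> H = {\<lambda>_. 0} \<and> {(\<lambda>i. x i + y i) | x y. x \<in> G \<and> y \<in> H} = Zn n)"

definition coord :: "(nat \<Rightarrow> nat \<Rightarrow> int) \<Rightarrow> nat \<Rightarrow> nat \<Rightarrow> (nat \<Rightarrow> int)" where
  "coord P n i = (\<lambda>j. if j < n then P i j else 0)"

definition sqsub :: "(nat \<Rightarrow> nat \<Rightarrow> int) \<Rightarrow> nat \<Rightarrow> nat \<Rightarrow> (nat \<Rightarrow> int) set \<Rightarrow> bool" where
  "sqsub P n m G \<longleftrightarrow> (\<forall>i<m. coord P n i \<in> G)"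

end

theory Submission
  imports Defs
begin

text \<open>Ranks over a field are detected by minors. Let \<open>S\<close> be the finite set of all exponents occurring
  in minors of the two boundary matrices at degree \<open>k\<close>. Whether \<open>p\<close> kills a minor depends only on which
  elements of \<open>S\<close> it identifies, and identifying more elements kills more minors, so it lowers both
  ranks and raises the Betti number. Each \<open>p\<close> satisfying the inequality thus contributes the subgroup
  \<open>G\<^sub>p\<close> of all functionals that identify the elements of \<open>S\<close> identified by \<open>p\<close>; there are only finitely
  many such subgroups. Being an annihilator, \<open>G\<^sub>p\<close> is full. If it were everything, \<open>p\<close> would be injective
  on \<open>S\<close> and could not raise the Betti number.\<close>

section \<open>Ranks and minors of matrices over a field\<close>

text \<open>Rank-nullity for multiplication by \<open>A\<close>, whose image is the column span. It
  turns the kernel dimension in \<open>hdim\<close> into a rank, so that Betti numbers depend on two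
  ranks only.\<close>

lemma rank_nullity_mat:
  fixes A :: "'a::field mat"
  assumes A: "A \<in> carrier_mat nr nc"
  shows "kernel_dim A = nc - vec_space.rank nr A"
proof -
  interpret K: kernel nr nc A by unfold_locales (rule A)
  interpret W: vec_space "TYPE('a)" nr .
  let ?T = "\<lambda>v. A *\<^sub>v v"
  have hom: "?T \<in> LinearCombinations.module_hom class_ring (module_vec TYPE('a) nc) (module_vec TYPE('a) nr)"
    unfolding LinearCombinations.module_hom_def
    using A by (simp add: mult_add_distrib_mat_vec[OF A] mult_mat_vec[OF A] module_vec_simps)
  have "VectorSpace.linear_map class_ring (module_vec TYPE('a) nc) (module_vec TYPE('a) nr) ?T"
    by (intro VectorSpace.linear_map.intro mod_hom.intro mod_hom_axioms.intro hom
        K.NC.vectorspace_axioms W.vectorspace_axioms K.NC.module_axioms W.module_axioms)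
  then interpret L: VectorSpace.linear_map class_ring "module_vec TYPE('a) nc" "module_vec TYPE('a) nr" ?T .
  have ker: "L.ker = mat_kernel A"
    unfolding L.ker_def using A by (auto simp: mat_kernel_def)
  have im: "L.im = W.span (set (cols A))"
  proof -
    have "W.span (set (cols A)) = {y \<in> carrier_vec nr. \<exists>x\<in>carrier_vec nc. A *\<^sub>v x = y}"
      using W.col_space_eq[OF A] A unfolding W.col_space_def by simp
    also have "\<dots> = (\<lambda>v. A *\<^sub>v v) ` carrier_vec nc"
      using A by auto
    finally show ?thesis unfolding L.im_def by simp
  qed
  have "vectorspace.dim class_ring (W.vs L.im) + vectorspace.dim class_ring (K.NC.vs L.ker) = K.NC.dim"
    by (rule L.rank_nullity) simp
  then have "W.rank A + K.dim = nc"
    unfolding ker im W.rank_def K.NC.dim_is_n by simp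
  then show ?thesis by simp
qed

text \<open>Phrased with index functions and finite sums, so that null vectors can be restricted,
  extended and rescaled without vector carriers.\<close>

lemma det_mat_eq_0_iff:
  fixes F :: "nat \<Rightarrow> nat \<Rightarrow> 'a::field"
  shows "det (mat r r (\<lambda>(i,j). F i j)) = 0 \<longleftrightarrow>
    (\<exists>v. (\<exists>j<r. v j \<noteq> 0) \<and> (\<forall>i<r. (\<Sum>j<r. F i j * v j) = 0))"
proof -
  let ?M = "mat r r (\<lambda>(i,j). F i j)"
  have M: "?M \<in> carrier_mat r r" by simp
  have mv: "?M *\<^sub>v v = 0\<^sub>v r \<longleftrightarrow> (\<forall>i<r. (\<Sum>j<r. F i j * v $ j) = 0)" if "v \<in> carrier_vec r" for v
    using that by (auto simp: vec_eq_iff scalar_prod_def atLeast0LessThan)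
  show ?thesis
    unfolding det_0_iff_vec_prod_zero_field[OF M]
  proof (intro iffI; elim exE conjE)
    fix v assume v: "v \<in> carrier_vec r" "v \<noteq> 0\<^sub>v r" "?M *\<^sub>v v = 0\<^sub>v r"
    then have "\<exists>j<r. v $ j \<noteq> 0" by (auto simp: vec_eq_iff)
    with v mv show "\<exists>v. (\<exists>j<r. v j \<noteq> 0) \<and> (\<forall>i<r. (\<Sum>j<r. F i j * v j) = 0)"
      by (intro exI[of _ "\<lambda>j. v $ j"]) auto
  next
    fix v j assume v: "\<forall>i<r. (\<Sum>j<r. F i j * v j) = 0" "j < r" "v j \<noteq> 0"
    then have "vec r v \<noteq> 0\<^sub>v r" by (auto simp: vec_eq_iff)
    moreover have "?M *\<^sub>v vec r v = 0\<^sub>v r"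
      using v by (subst mv) auto
    ultimately show "\<exists>v. v \<in> carrier_vec r \<and> v \<noteq> 0\<^sub>v r \<and> ?M *\<^sub>v v = 0\<^sub>v r"
      by (intro exI[of _ "vec r v"]) simp
  qed
qed

lemma nth_less_of_subset: "\<lbrakk>set xs \<subseteq> {..<n}; i < length xs\<rbrakk> \<Longrightarrow> xs ! i < n"
  using nth_mem by blast

text \<open>Index lists instead of index sets: bordering a minor is appending one entry to each
  list. For lists of equal length, repetitions only produce minors equal to 0.\<close>

definition minor :: "'a::comm_ring_1 mat \<Rightarrow> nat list \<Rightarrow> nat list \<Rightarrow> 'a" where
  "minor A xs ys = det (mat (length xs) (length xs) (\<lambda>(i, j). A $$ (xs ! i, ys ! j)))"

text \<open>A nonzero minor of the first columns can be bordered by one of the rows: otherwise every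
  row yields the same dependency between the columns.\<close>
lemma independent_columns_minor:
  fixes A :: "'a::field mat"
  assumes "\<And>v j. \<lbrakk>\<And>i. i < nr \<Longrightarrow> (\<Sum>j<length ys. A $$ (i, ys ! j) * v j) = 0; j < length ys\<rbrakk> \<Longrightarrow> v j = 0"
  shows "\<exists>xs. length xs = length ys \<and> set xs \<subseteq> {..<nr} \<and> minor A xs ys \<noteq> 0"
  using assms
proof (induction ys rule: rev_induct)
  case Nil
  then show ?case by (auto simp: minor_def)
next
  case (snoc y ys)
  let ?r = "length ys"
  have "\<exists>xs. length xs = ?r \<and> set xs \<subseteq> {..<nr} \<and> minor A xs ys \<noteq> 0"
  proof (rule snoc.IH)
    fix v :: "nat \<Rightarrow> 'a" and j
    assume v: "\<And>i. i < nr \<Longrightarrow> (\<Sum>j<?r. A $$ (i, ys ! j) * v j) = 0" and j: "j < ?r"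
    \<comment> \<open>A dependency among the columns \<open>ys\<close> extends by coefficient 0 to
      \<open>ys @ [y]\<close>.\<close>
    have "(v(?r := 0)) j = 0"
      using v j by (intro snoc.prems[of "v(?r := 0)" j]) (simp_all add: nth_append)
    then show "v j = 0" using j by simp
  qed
  then obtain xs where xs: "length xs = ?r" "set xs \<subseteq> {..<nr}" "minor A xs ys \<noteq> 0" by blast
  \<comment> \<open>As the minor is nonzero, the rows \<open>xs\<close> determine the coefficients
    of a combination of the columns \<open>ys\<close>.\<close>
  have inj: "v j = w j"
    if "\<And>i. i < ?r \<Longrightarrow> (\<Sum>j<?r. A $$ (xs ! i, ys ! j) * v j) = (\<Sum>j<?r. A $$ (xs ! i, ys ! j) * w j)"
      "j < ?r" for v w j
  proof -
    let ?u = "\<lambda>j. v j - w j"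
    have "\<not> ((\<exists>j<?r. ?u j \<noteq> 0) \<and> (\<forall>i<?r. (\<Sum>j<?r. A $$ (xs ! i, ys ! j) * ?u j) = 0))"
      using xs(3) unfolding minor_def xs(1) det_mat_eq_0_iff not_ex by (rule spec)
    moreover have "\<forall>i<?r. (\<Sum>j<?r. A $$ (xs ! i, ys ! j) * ?u j) = 0"
      using that(1) by (simp add: right_diff_distrib sum_subtractf)
    ultimately show ?thesis using that(2) by simp
  qed
  show ?case
  proof (rule ccontr)
    assume "\<not> ?thesis"
    then have zero: "minor A (xs @ [i]) (ys @ [y]) = 0" if "i < nr" for i
      using that xs by (auto dest: spec[of _ "xs @ [i]"])
    \<comment> \<open>A null vector of the vanishing bordered minor, divided by its last entry,
      expresses column \<open>y\<close> through the columns \<open>ys\<close> on the rows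
      \<open>xs\<close> and \<open>i\<close>.\<close>
    have dep: "\<exists>v. (\<forall>l<?r. (\<Sum>j<?r. A $$ (xs ! l, ys ! j) * v j) = - A $$ (xs ! l, y)) \<and>
        (\<Sum>j<?r. A $$ (i, ys ! j) * v j) = - A $$ (i, y)" if i: "i < nr" for i
    proof -
      obtain u where u: "\<exists>j<Suc ?r. u j \<noteq> 0"
        "\<And>l. l < Suc ?r \<Longrightarrow> (\<Sum>j<Suc ?r. A $$ ((xs @ [i]) ! l, (ys @ [y]) ! j) * u j) = 0"
        using zero[OF i] unfolding minor_def by (auto simp: det_mat_eq_0_iff xs(1))
      have u1: "(\<Sum>j<?r. A $$ (xs ! l, ys ! j) * u j) + A $$ (xs ! l, y) * u ?r = 0" if "l < ?r" for l
        using u(2)[of l] that xs(1) by (simp add: nth_append)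
      have u2: "(\<Sum>j<?r. A $$ (i, ys ! j) * u j) + A $$ (i, y) * u ?r = 0"
        using u(2)[of ?r] xs(1) by (simp add: nth_append)
      have ur: "u ?r \<noteq> 0"
      proof
        assume "u ?r = 0"
        with u1 have "u j = 0" if "j < ?r" for j
          using that inj[of u "\<lambda>_. 0" j] by simp
        with \<open>u ?r = 0\<close> u(1) show False by (auto simp: less_Suc_eq)
      qed
      have scale: "(\<Sum>j<?r. A $$ (l, ys ! j) * (u j / u ?r)) = - A $$ (l, y)"
        if "(\<Sum>j<?r. A $$ (l, ys ! j) * u j) + A $$ (l, y) * u ?r = 0" for l
      proof -
        have "(\<Sum>j<?r. A $$ (l, ys ! j) * (u j / u ?r)) = (\<Sum>j<?r. A $$ (l, ys ! j) * u j) / u ?r"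
          by (simp add: sum_divide_distrib)
        also have "\<dots> = - A $$ (l, y)"
          using that ur by (simp add: field_simps eq_neg_iff_add_eq_0)
        finally show ?thesis .
      qed
      show ?thesis
        using scale u1 u2 by (intro exI[of _ "\<lambda>j. u j / u ?r"]) blast
    qed
    \<comment> \<open>Without rows any \<open>w\<close> will do. Otherwise the coefficients obtained
      for row 0 serve every row, since by \<open>inj\<close> the rows \<open>xs\<close> already fix
      them.\<close>
    obtain w where w: "\<And>i. i < nr \<Longrightarrow> (\<Sum>j<?r. A $$ (i, ys ! j) * w j) = - A $$ (i, y)"
    proof (cases "nr = 0")
      case False
      then obtain v where v: "\<forall>l<?r. (\<Sum>j<?r. A $$ (xs ! l, ys ! j) * v j) = - A $$ (xs ! l, y)"
        using dep[of 0] by auto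
      have "(\<Sum>j<?r. A $$ (i, ys ! j) * v j) = - A $$ (i, y)" if i: "i < nr" for i
      proof -
        obtain u where u: "\<forall>l<?r. (\<Sum>j<?r. A $$ (xs ! l, ys ! j) * u j) = - A $$ (xs ! l, y)"
          "(\<Sum>j<?r. A $$ (i, ys ! j) * u j) = - A $$ (i, y)" using dep[OF i] by blast
        have "v j = u j" if "j < ?r" for j
          using that u(1) v by (intro inj[of v u j]) simp_all
        with u(2) show ?thesis by simp
      qed
      with that show ?thesis by blast
    qed (auto intro: that)
    \<comment> \<open>Coefficient 1 on the new column makes \<open>w\<close> a dependency among all
      of \<open>ys @ [y]\<close>, which the hypothesis forces to be trivial.\<close>
    have "(w(?r := 1)) ?r = 0"
      by (rule snoc.prems[of "w(?r := 1)" ?r]) (simp_all add: nth_append w)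
    then show False by simp
  qed
qed

text \<open>A maximal independent set of columns has as many elements as the rank;
  \<open>independent_columns_minor\<close> then supplies matching rows.\<close>

lemma minor_rank_exists:
  fixes A :: "'a::field mat"
  assumes A: "A \<in> carrier_mat nr nc"
  obtains xs ys where "length xs = vec_space.rank nr A" "length ys = vec_space.rank nr A"
    "set xs \<subseteq> {..<nr}" "set ys \<subseteq> {..<nc}" "minor A xs ys \<noteq> 0"
proof -
  interpret vec_space "TYPE('a)" nr .
  obtain S where S: "maximal S (\<lambda>T. T \<subseteq> set (cols A) \<and> lin_indpt T)" "finite S"
    using maximal_exists_superset[of "set (cols A)" "\<lambda>T. T \<subseteq> set (cols A) \<and> lin_indpt T" "{}"]
    by (auto simp: finite_lin_indpt2)
  then have indpt: "S \<subseteq> set (cols A)" "lin_indpt S" by (auto simp: maximal_def)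
  obtain vs where vs: "set vs = S" "distinct vs"
    using finite_distinct_list[OF S(2)] by blast
  have "\<forall>v\<in>set vs. \<exists>j<nc. v = col A j"
    using indpt(1) vs(1) A by (fastforce simp: cols_def)
  then obtain g where g: "\<And>v. v \<in> set vs \<Longrightarrow> g v < nc \<and> v = col A (g v)" by metis
  define ys where "ys = map g vs"
  have len: "length ys = rank A"
    using rank_card_indpt[OF A S(1)] vs by (auto simp: ys_def distinct_card)
  have ys: "set ys \<subseteq> {..<nc}" using g by (auto simp: ys_def)
  define B where "B = mat_of_cols nr vs"
  have "set vs \<subseteq> carrier_vec nr"
    using indpt(1) vs(1) A cols_dim by blast
  then have cols: "cols B = vs" and B: "B \<in> carrier_mat nr (length ys)"
    by (auto simp: B_def ys_def)
  have entry: "B $$ (i, j) = A $$ (i, ys ! j)" if "i < nr" "j < length ys" for i j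
  proof -
    have j: "j < length vs" using that(2) by (simp add: ys_def)
    have "B $$ (i, j) = vs ! j $ i" using that(1) j by (simp add: B_def mat_of_cols_def)
    also have "\<dots> = col A (g (vs ! j)) $ i" using g[OF nth_mem[OF j]] by metis
    also have "\<dots> = A $$ (i, ys ! j)" using that(1) j conjunct1[OF g[OF nth_mem[OF j]]] A by (simp add: ys_def)
    finally show ?thesis .
  qed
  have "\<exists>xs. length xs = length ys \<and> set xs \<subseteq> {..<nr} \<and> minor A xs ys \<noteq> 0"
  proof (rule independent_columns_minor)
    fix v :: "nat \<Rightarrow> 'a" and j
    assume v: "\<And>i. i < nr \<Longrightarrow> (\<Sum>j<length ys. A $$ (i, ys ! j) * v j) = 0" and j: "j < length ys"
    have "B *\<^sub>v vec (length ys) v = 0\<^sub>v nr"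
      using v B by (auto simp: vec_eq_iff scalar_prod_def atLeast0LessThan entry)
    with lin_depI[OF B, of "vec (length ys) v"] have "vec (length ys) v = 0\<^sub>v (length ys)"
      using indpt(2) vs cols by auto
    with j show "v j = 0" by (auto simp: vec_eq_iff)
  qed
  with len ys show ?thesis by (metis that)
qed

text \<open>A dependency among the columns \<open>ys\<close> restricts to the rows
  \<open>xs\<close>, where the nonzero minor makes it trivial. These columns are therefore
  independent.\<close>

lemma minor_le_rank:
  fixes A :: "'a::field mat"
  assumes A: "A \<in> carrier_mat nr nc" and len: "length xs = length ys"
    and xs: "set xs \<subseteq> {..<nr}" and ys: "set ys \<subseteq> {..<nc}" and nz: "minor A xs ys \<noteq> 0"
  shows "length xs \<le> vec_space.rank nr A"
proof -
  interpret vec_space "TYPE('a)" nr .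
  let ?r = "length ys"
  define B where "B = mat_of_cols nr (map (col A) ys)"
  have "set (map (col A) ys) \<subseteq> carrier_vec nr" using A by auto
  then have B: "B \<in> carrier_mat nr ?r" and cols: "cols B = map (col A) ys"
    by (auto simp: B_def)
  have entry: "B $$ (i, j) = A $$ (i, ys ! j)" if "i < nr" "j < ?r" for i j
    using that A nth_less_of_subset[OF ys that(2)] by (simp add: B_def mat_of_cols_def)
  have triv: "v j = 0"
    if "\<And>i. i < nr \<Longrightarrow> (\<Sum>j<?r. A $$ (i, ys ! j) * v j) = 0" "j < ?r" for v j
  proof -
    have "(\<Sum>j<?r. A $$ (xs ! i, ys ! j) * v j) = 0" if "i < ?r" for i
      using \<open>\<And>i. i < nr \<Longrightarrow> _\<close> that len nth_less_of_subset[OF xs] by simp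
    with nz that(2) show ?thesis unfolding minor_def len det_mat_eq_0_iff by blast
  qed
  \<comment> \<open>Independence concerns the set of columns, so its size has to be secured: two
    equal columns at positions \<open>i\<close> and \<open>j\<close> would give the dependency with
    coefficients 1 and -1 there.\<close>
  have dist: "distinct (map (col A) ys)"
  proof (unfold distinct_conv_nth, intro allI impI notI)
    fix i j assume ij: "i < length (map (col A) ys)" "j < length (map (col A) ys)" "i \<noteq> j"
      and eq: "map (col A) ys ! i = map (col A) ys ! j"
    have eq': "A $$ (l, ys ! i) = A $$ (l, ys ! j)" if "l < nr" for l
      using arg_cong[OF eq, of "\<lambda>v. v $ l"] that A ij nth_less_of_subset[OF ys] by simp
    have "(\<Sum>k<?r. A $$ (l, ys ! k) * ((if k = i then 1 else 0) - (if k = j then 1 else 0))) = 0" if "l < nr" for l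
    proof -
      have "(\<Sum>k<?r. A $$ (l, ys ! k) * ((if k = i then 1 else 0) - (if k = j then 1 else 0))) =
          (\<Sum>k<?r. (if k = i then A $$ (l, ys ! k) else 0) - (if k = j then A $$ (l, ys ! k) else 0))"
        by (intro sum.cong) auto
      then show ?thesis using ij eq'[OF that] by (simp add: sum_subtractf)
    qed
    from triv[OF this, of i] ij show False by simp
  qed
  have "lin_indpt (set (cols B))"
  proof
    assume "lin_dep (set (cols B))"
    then obtain v where v: "v \<in> carrier_vec ?r" "v \<noteq> 0\<^sub>v ?r" "B *\<^sub>v v = 0\<^sub>v nr"
      using lin_depE[OF B] dist cols by metis
    have "(\<Sum>j<?r. A $$ (i, ys ! j) * v $ j) = 0" if "i < nr" for i
      using arg_cong[OF v(3), of "\<lambda>v. v $ i"] that v(1) B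
      by (simp add: scalar_prod_def atLeast0LessThan entry)
    then have "v $ j = 0" if "j < ?r" for j using triv that by blast
    with v(1,2) show False by (auto simp: vec_eq_iff)
  qed
  moreover have "set (cols B) \<subseteq> set (cols A)"
    unfolding cols using ys A by (auto simp: cols_def)
  ultimately have "card (set (cols B)) \<le> rank A" using rank_ge_card_indpt[OF A] by blast
  moreover have "card (set (cols B)) = ?r" using distinct_card[OF dist] cols by simp
  ultimately show ?thesis using len by simp
qed

lemma (in comm_ring_hom) hom_minor:
  assumes "A \<in> carrier_mat nr nc" "length ys = length xs" "set xs \<subseteq> {..<nr}" "set ys \<subseteq> {..<nc}"
  shows "minor (map_mat hom A) xs ys = hom (minor A xs ys)"
proof -
  have "xs ! i < nr" "ys ! i < nc" if "i < length xs" for i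
    using assms that by (simp_all add: nth_less_of_subset)
  then have "mat (length xs) (length xs) (\<lambda>(i, j). map_mat hom A $$ (xs ! i, ys ! j)) =
      map_mat hom (mat (length xs) (length xs) (\<lambda>(i, j). A $$ (xs ! i, ys ! j)))"
    using assms(1) by (intro eq_matI) auto
  then show ?thesis by (simp add: minor_def)
qed

text \<open>The length bound keeps the set finite and still admits every minor whose size is the
  rank of an image of \<open>A\<close> over a field.\<close>

definition minors :: "'a::comm_ring_1 mat \<Rightarrow> 'a set" where
  "minors A = (\<lambda>(xs, ys). minor A xs ys) `
     {(xs, ys). length ys = length xs \<and> length xs \<le> dim_col A \<and> set xs \<subseteq> {..<dim_row A} \<and> set ys \<subseteq> {..<dim_col A}}"

lemma finite_minors: "finite (minors A)"
proof -
  have "{(xs, ys). length ys = length xs \<and> length xs \<le> dim_col A \<and> set xs \<subseteq> {..<dim_row A} \<and> set ys \<subseteq> {..<dim_col A}}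
    \<subseteq> {xs. set xs \<subseteq> {..<dim_row A} \<and> length xs \<le> dim_col A} \<times> {ys. set ys \<subseteq> {..<dim_col A} \<and> length ys \<le> dim_col A}"
    by auto
  then show ?thesis
    unfolding minors_def by (intro finite_imageI) (auto elim!: finite_subset simp: finite_lists_length_le)
qed

text \<open>A minor whose size is the rank of the \<open>h\<close>-image and which survives
  \<open>h\<close> also survives \<open>g\<close>, because \<open>g\<close> kills no minor that
  \<open>h\<close> keeps.\<close>

lemma rank_map_mat_mono:
  fixes g :: "'a::comm_ring_1 \<Rightarrow> 'b::field" and h :: "'a \<Rightarrow> 'c::field"
  assumes g: "comm_ring_hom g" and h: "comm_ring_hom h" and A: "A \<in> carrier_mat nr nc"
    and ker: "\<And>f. \<lbrakk>f \<in> minors A; g f = 0\<rbrakk> \<Longrightarrow> h f = 0"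
  shows "vec_space.rank nr (map_mat h A) \<le> vec_space.rank nr (map_mat g A)"
proof -
  interpret g: comm_ring_hom g by fact
  interpret h: comm_ring_hom h by fact
  have hA: "map_mat h A \<in> carrier_mat nr nc" and gA: "map_mat g A \<in> carrier_mat nr nc" using A by auto
  obtain xs ys where len: "length xs = vec_space.rank nr (map_mat h A)" "length ys = vec_space.rank nr (map_mat h A)"
    and sets: "set xs \<subseteq> {..<nr}" "set ys \<subseteq> {..<nc}" and nz: "minor (map_mat h A) xs ys \<noteq> 0"
    using minor_rank_exists[OF hA] by blast
  have "length xs \<le> nc" using vec_space.rank_le_nc[OF hA] len(1) by simp
  then have "minor A xs ys \<in> minors A"
    using A len sets unfolding minors_def by force
  then have "minor (map_mat g A) xs ys \<noteq> 0"
    using ker nz A len sets by (auto simp: g.hom_minor h.hom_minor)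
  then show ?thesis using minor_le_rank[OF gA _ sets] len by auto
qed

section \<open>Change of exponents in group rings\<close>

text \<open>The linear extension of a map of exponents. The map need not be additive, which allows
  composition with plain set maps.\<close>

definition push_exp :: "('b \<Rightarrow> 'c) \<Rightarrow> ('b \<Rightarrow>\<^sub>0 'a::comm_monoid_add) \<Rightarrow> ('c \<Rightarrow>\<^sub>0 'a)" where
  "push_exp \<phi> f = (\<Sum>a\<in>Poly_Mapping.keys f. Poly_Mapping.single (\<phi> a) (Poly_Mapping.lookup f a))"

lemma hom_ring_eq_push_exp: "hom_ring P n m = push_exp (hom_exp P n m)"
  by (simp add: fun_eq_iff hom_ring_def push_exp_def)

lemma push_exp_superset:
  assumes "finite A" "Poly_Mapping.keys f \<subseteq> A"
  shows "push_exp \<phi> f = (\<Sum>a\<in>A. Poly_Mapping.single (\<phi> a) (Poly_Mapping.lookup f a))"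
  unfolding push_exp_def by (rule sum.mono_neutral_left) (use assms in \<open>auto simp: in_keys_iff\<close>)

lemma push_exp_0 [simp]: "push_exp \<phi> 0 = 0"
  by (simp add: push_exp_def)

lemma push_exp_single [simp]: "push_exp \<phi> (Poly_Mapping.single a x) = Poly_Mapping.single (\<phi> a) x"
  by (cases "x = 0") (simp_all add: push_exp_def)

lemma push_exp_add: "push_exp \<phi> (f + g) = push_exp \<phi> f + push_exp \<phi> g"
proof -
  let ?A = "Poly_Mapping.keys f \<union> Poly_Mapping.keys g"
  have "finite ?A" by simp
  note push = push_exp_superset[OF this]
  have "Poly_Mapping.keys (f + g) \<subseteq> ?A" by (rule Poly_Mapping.keys_add)
  then show ?thesis
    by (simp add: push lookup_add single_add sum.distrib)
qed

lemma push_exp_sum: "push_exp \<phi> (sum F I) = (\<Sum>i\<in>I. push_exp \<phi> (F i))"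
  by (induction I rule: infinite_finite_induct) (simp_all add: push_exp_add)

lemma push_exp_id: "push_exp (\<lambda>a. a) f = f"
  by (intro poly_mapping_eqI)
    (simp add: push_exp_def lookup_sum lookup_single when_def in_keys_iff)

lemma push_exp_push_exp: "push_exp \<psi> (push_exp \<phi> f) = push_exp (\<lambda>a. \<psi> (\<phi> a)) f"
  unfolding push_exp_def[of \<phi>] by (simp add: push_exp_sum push_exp_def[of "\<lambda>a. \<psi> (\<phi> a)"])

text \<open>On the keys of \<open>f\<close>, the map \<open>\<psi>\<close> factors through
  \<open>\<phi>\<close>, so the image under \<open>\<psi>\<close> is a pushforward of the image
  under \<open>\<phi>\<close>, which is 0.\<close>

lemma push_exp_eq_0_mono:
  assumes "push_exp \<phi> f = 0"
    and "\<And>a b. \<lbrakk>a \<in> Poly_Mapping.keys f; b \<in> Poly_Mapping.keys f; \<phi> a = \<phi> b\<rbrakk> \<Longrightarrow> \<psi> a = \<psi> b"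
  shows "push_exp \<psi> f = 0"
proof -
  \<comment> \<open>The factoring set map: any preimage among the keys gives the same value of
    \<open>\<psi>\<close>. Outside the image of the keys the value is arbitrary.\<close>
  define \<chi> where "\<chi> = (\<lambda>l. \<psi> (SOME a. a \<in> Poly_Mapping.keys f \<and> \<phi> a = l))"
  have "\<chi> (\<phi> a) = \<psi> a" if "a \<in> Poly_Mapping.keys f" for a
    unfolding \<chi>_def using someI[of "\<lambda>b. b \<in> Poly_Mapping.keys f \<and> \<phi> b = \<phi> a" a] that assms(2) by blast
  then have "push_exp \<psi> f = push_exp \<chi> (push_exp \<phi> f)"
    unfolding push_exp_push_exp by (simp add: push_exp_def)
  with assms(1) show ?thesis by simp
qed

lemma comm_ring_hom_push_exp:
  fixes \<phi> :: "'b::comm_monoid_add \<Rightarrow> 'c::comm_monoid_add"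
  assumes zero: "\<phi> 0 = 0" and add: "\<And>a b. \<phi> (a + b) = \<phi> a + \<phi> b"
  shows "comm_ring_hom (push_exp \<phi> :: ('b \<Rightarrow>\<^sub>0 'a::comm_ring_1) \<Rightarrow> _)"
proof (unfold_locales, goal_cases)
  \<comment> \<open>Multiplicativity: after expansion into monomials it reduces to additivity of
    \<open>\<phi>\<close>.\<close>
  case (4 f g)
  have fg: "f * g = (\<Sum>a\<in>Poly_Mapping.keys f. \<Sum>b\<in>Poly_Mapping.keys g.
      Poly_Mapping.single (a + b) (Poly_Mapping.lookup f a * Poly_Mapping.lookup g b))"
  proof -
    have "f * g = push_exp (\<lambda>a. a) f * push_exp (\<lambda>a. a) g" by (simp add: push_exp_id)
    then show ?thesis by (simp add: push_exp_def sum_product mult_single)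
  qed
  show ?case
    unfolding fg push_exp_sum
    by (simp add: push_exp_def[of _ f] push_exp_def[of _ g] sum_product mult_single add)
qed (simp_all add: push_exp_add zero flip: single_one)

text \<open>The function inside \<open>hom_exp\<close> is supported below \<open>m\<close>, so
  \<open>Abs_poly_mapping\<close> is applied to a finitely supported function.\<close>

lemma lookup_hom_exp:
  "Poly_Mapping.lookup (hom_exp P n m a) i = (if i < m then (\<Sum>j<n. P i j * Poly_Mapping.lookup a j) else 0)"
proof -
  have "finite {i. (if i < m then (\<Sum>j<n. P i j * Poly_Mapping.lookup a j) else 0) \<noteq> 0}"
    by (rule finite_subset[of _ "{..<m}"]) auto
  then show ?thesis unfolding hom_exp_def by (simp add: lookup_Abs_poly_mapping)
qed

lemma comm_ring_hom_hom_ring: "comm_ring_hom (hom_ring P n m :: 'a::comm_ring_1 laurent \<Rightarrow> _)"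
  unfolding hom_ring_eq_push_exp
  by (rule comm_ring_hom_push_exp; rule poly_mapping_eqI)
    (simp_all add: lookup_hom_exp lookup_add distrib_left sum.distrib)

text \<open>\<open>L\<^sub>n\<close> is the set of fixed points of the ring endomorphism that sets
  the variables from index \<open>n\<close> on to 1, hence closed under minors.\<close>
lemma in_L_iff_hom_ring_id:
  "in_L n f \<longleftrightarrow> hom_ring (\<lambda>i j. if i = j then 1 else 0) n n f = f"
proof
  let ?I = "hom_exp (\<lambda>i j. if i = j then 1 else 0) n n"
  have I: "Poly_Mapping.lookup (?I a) i = (if i < n then Poly_Mapping.lookup a i else 0)" for a i
    by (simp add: lookup_hom_exp if_distrib[of "\<lambda>x. x * _"] cong: if_cong)
  {
    assume "in_L n f"
    then have "?I a = a" if "a \<in> Poly_Mapping.keys f" for a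
      using that by (intro poly_mapping_eqI) (auto simp: I in_L_def)
    then have "push_exp ?I f = push_exp (\<lambda>a. a) f"
      unfolding push_exp_def by (intro sum.cong) simp_all
    then show "hom_ring (\<lambda>i j. if i = j then 1 else 0) n n f = f"
      by (simp add: hom_ring_eq_push_exp push_exp_id)
  next
    assume "hom_ring (\<lambda>i j. if i = j then 1 else 0) n n f = f"
    then have "Poly_Mapping.keys f = Poly_Mapping.keys (push_exp ?I f)"
      by (simp add: hom_ring_eq_push_exp)
    also have "\<dots> \<subseteq> range ?I"
      unfolding push_exp_def by (rule order.trans[OF keys_sum]) (auto split: if_splits)
    finally show "in_L n f"
      using I by (auto simp: in_L_def)
  }
qed

lemma in_L_minors:
  assumes A: "A \<in> carrier_mat nr nc" and entries: "\<And>i j. \<lbrakk>i < nr; j < nc\<rbrakk> \<Longrightarrow> in_L n (A $$ (i, j))"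
    and f: "f \<in> minors A"
  shows "in_L n f"
proof -
  let ?h = "hom_ring (\<lambda>i j. if i = j then 1 else 0) n n"
  interpret comm_ring_hom ?h by (rule comm_ring_hom_hom_ring)
  have "map_mat ?h A = A"
    using A entries by (intro eq_matI) (auto simp: in_L_iff_hom_ring_id)
  with f A show ?thesis
    by (auto simp: minors_def in_L_iff_hom_ring_id simp flip: hom_minor[OF A])
qed

lemma comm_ring_hom_Fract:
  assumes "comm_ring_hom (h :: 'a::comm_ring_1 \<Rightarrow> 'b::idom)"
  shows "comm_ring_hom (\<lambda>f. Fract (h f) 1)"
proof -
  interpret comm_ring_hom h by fact
  show ?thesis by unfold_locales (simp_all add: hom_distribs Zero_fract_def One_fract_def)
qed

section \<open>Full subgroups and annihilators\<close>

lemma full_subgroup_Zn: "full_subgroup n (Zn n)"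
  unfolding full_subgroup_def
  by (intro conjI exI[of _ "{\<lambda>_. 0}"]) (auto simp: subgroup_Zn_def Zn_def)

text \<open>The image of \<open>G\<close> under the functional is cyclic; the multiples of a preimage \<open>x\<close>
  of a generator form a complement of the kernel inside \<open>G\<close>.\<close>
lemma full_subgroup_kernel:
  assumes G: "full_subgroup n G"
  shows "full_subgroup n {v \<in> G. (\<Sum>j<n. v j * w j) = (0::int)}"
proof -
  define \<phi> where "\<phi> v = (\<Sum>j<n. v j * w j)" for v
  have \<phi>_lin: "\<phi> (\<lambda>i. x i + t * y i) = \<phi> x + t * \<phi> y" for x y t
    by (simp add: \<phi>_def algebra_simps sum.distrib sum_distrib_left)
  obtain H where H: "subgroup_Zn n H" "G \<inter> H = {\<lambda>_. 0}"
    "{(\<lambda>i. x i + y i) |x y. x \<in> G \<and> y \<in> H} = Zn n"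
    using G unfolding full_subgroup_def by blast
  have sub: "subgroup_Zn n G" using G by (simp add: full_subgroup_def)
  have add: "(\<lambda>i. x i + y i) \<in> K" if "subgroup_Zn n K" "x \<in> K" "y \<in> K" for K x y
    using that by (auto simp: subgroup_Zn_def)
  have mult: "(\<lambda>i. t * x i) \<in> K" if "subgroup_Zn n K" "x \<in> K" for K t x
  proof (induction t rule: int_induct[of _ 0])
    case base then show ?case using that by (simp add: subgroup_Zn_def)
  next
    case (step1 t)
    from add[OF that(1) step1(2) that(2)] show ?case by (simp add: algebra_simps)
  next
    case (step2 t)
    have "(\<lambda>i. - x i) \<in> K" using that by (simp add: subgroup_Zn_def)
    from add[OF that(1) step2(2) this] show ?case by (simp add: algebra_simps)
  qed
  have lin: "(\<lambda>i. x i + t * y i) \<in> K" if "subgroup_Zn n K" "x \<in> K" "y \<in> K" for K t x y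
    using add[OF that(1,2) mult[OF that(1,3)]] .
  show ?thesis
  proof (cases "\<forall>x\<in>G. \<phi> x = 0")
    case True
    then have "{v \<in> G. \<phi> v = 0} = G" by auto
    with G show ?thesis by (simp add: \<phi>_def)
  next
    case False
    then obtain x0 where x0: "x0 \<in> G" "\<phi> x0 \<noteq> 0" by blast
    \<comment> \<open>The least nonzero absolute value makes \<open>\<phi> x\<close> a generator of
      the image of \<open>G\<close>.\<close>
    obtain x where x: "x \<in> G" "\<phi> x \<noteq> 0"
      and min: "\<And>y. \<lbrakk>y \<in> G; \<phi> y \<noteq> 0\<rbrakk> \<Longrightarrow> nat \<bar>\<phi> x\<bar> \<le> nat \<bar>\<phi> y\<bar>"
      using ex_has_least_nat[of "\<lambda>x. x \<in> G \<and> \<phi> x \<noteq> 0" x0 "\<lambda>x. nat \<bar>\<phi> x\<bar>"] x0 by blast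
    have dvd: "\<phi> x dvd \<phi> y" if y: "y \<in> G" for y
    proof (rule ccontr)
      \<comment> \<open>Division with remainder: \<open>\<phi> ?z\<close> is the remainder of
        \<open>\<phi> y\<close> modulo \<open>\<phi> x\<close>, and would contradict
        minimality.\<close>
      let ?z = "\<lambda>i. y i + - (\<phi> y div \<phi> x) * x i"
      assume nd: "\<not> \<phi> x dvd \<phi> y"
      have z: "?z \<in> G" using lin[OF sub y x(1)] .
      have "\<phi> ?z = \<phi> y mod \<phi> x"
        unfolding \<phi>_lin by (simp add: minus_div_mult_eq_mod[symmetric])
      with nd x(2) have "\<phi> ?z \<noteq> 0" "\<bar>\<phi> ?z\<bar> < \<bar>\<phi> x\<bar>"
        by (auto simp: dvd_eq_mod_eq_0 abs_mod_less)
      with min[OF z] show False by linarith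
    qed
    \<comment> \<open>The complement \<open>H\<close> of \<open>G\<close>, enlarged by the multiples
      of \<open>x\<close>, is to be a complement of the kernel \<open>?K\<close> in
      \<open>Zn n\<close>.\<close>
    let ?K = "{v \<in> G. \<phi> v = 0}" and ?H = "{(\<lambda>i. h i + t * x i) |h t. h \<in> H}"
    have GZ: "G \<subseteq> Zn n" and HZ: "H \<subseteq> Zn n" using sub H(1) by (auto simp: subgroup_Zn_def)
    have "subgroup_Zn n ?K"
    proof -
      have "\<phi> (\<lambda>_. 0) = 0" by (simp add: \<phi>_def)
      then show ?thesis
        using sub \<phi>_lin[of _ 1] \<phi>_lin[of "\<lambda>_. 0" "-1"] by (auto simp: subgroup_Zn_def)
    qed
    moreover have "subgroup_Zn n ?H"
      unfolding subgroup_Zn_def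
    proof (intro conjI ballI)
      show "?H \<subseteq> Zn n" using GZ HZ x(1) by (fastforce simp: Zn_def)
      show "(\<lambda>_. 0) \<in> ?H" using H(1) by (force simp: subgroup_Zn_def intro: exI[of _ "0::int"])
      fix u assume "u \<in> ?H"
      then obtain h s where u: "u = (\<lambda>i. h i + s * x i)" "h \<in> H" by blast
      show "(\<lambda>i. - u i) \<in> ?H"
        using H(1) u by (intro CollectI exI[of _ "\<lambda>i. - h i"] exI[of _ "-s"]) (auto simp: subgroup_Zn_def)
      fix v assume "v \<in> ?H"
      then obtain h' t where v: "v = (\<lambda>i. h' i + t * x i)" "h' \<in> H" by blast
      show "(\<lambda>i. u i + v i) \<in> ?H"
        using H(1) u v by (intro CollectI exI[of _ "\<lambda>i. h i + h' i"] exI[of _ "s + t"])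
          (auto simp: subgroup_Zn_def algebra_simps)
    qed
    moreover have "?K \<inter> ?H = {\<lambda>_. 0}"
    proof (intro equalityI subsetI)
      fix u assume "u \<in> ?K \<inter> ?H"
      then obtain h t where u: "u \<in> G" "\<phi> u = 0" "u = (\<lambda>i. h i + t * x i)" "h \<in> H" by blast
      have "(\<lambda>i. u i + - t * x i) \<in> G" using lin[OF sub u(1) x(1)] .
      then have "h \<in> G" by (simp add: u(3))
      then have h: "h = (\<lambda>_. 0)" using u(4) H(2) by blast
      then have "t * \<phi> x = 0" using u(2) \<phi>_lin[of h t x] by (simp add: u(3) \<phi>_def)
      with x(2) h u(3) show "u \<in> {\<lambda>_. 0}" by simp
    next
      fix u :: "nat \<Rightarrow> int" assume "u \<in> {\<lambda>_. 0}"
      then show "u \<in> ?K \<inter> ?H"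
        using \<open>subgroup_Zn n ?K\<close> \<open>subgroup_Zn n ?H\<close> by (simp add: subgroup_Zn_def)
    qed
    moreover have "{(\<lambda>i. y i + z i) |y z. y \<in> ?K \<and> z \<in> ?H} = Zn n"
    proof (intro equalityI subsetI)
      fix u assume "u \<in> {(\<lambda>i. y i + z i) |y z. y \<in> ?K \<and> z \<in> ?H}"
      then obtain y h t where u: "u = (\<lambda>i. y i + (h i + t * x i))" "y \<in> G" "h \<in> H" by auto
      then have "x \<in> Zn n" "y \<in> Zn n" "h \<in> Zn n" using x(1) GZ HZ by auto
      then show "u \<in> Zn n" by (simp add: Zn_def u(1))
    next
      fix u assume "u \<in> Zn n"
      then obtain y h where u: "u = (\<lambda>i. y i + h i)" "y \<in> G" "h \<in> H" using H(3) by blast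
      \<comment> \<open>Subtracting \<open>t\<close> times \<open>x\<close> moves the
        \<open>G\<close>-component \<open>y\<close> into the kernel; the multiple is absorbed by
        \<open>?H\<close>.\<close>
      obtain t where t: "\<phi> y = \<phi> x * t" using dvd[OF u(2)] by (rule dvdE)
      have K: "(\<lambda>i. y i + - t * x i) \<in> ?K"
        using lin[OF sub u(2) x(1), of "- t"] \<phi>_lin[of y "- t" x] t by (auto simp: algebra_simps)
      have H: "(\<lambda>i. h i + t * x i) \<in> ?H" using u(3) by blast
      have "u = (\<lambda>i. (y i + - t * x i) + (h i + t * x i))" by (simp add: u(1))
      from this K H have "u = (\<lambda>i. (y i + - t * x i) + (h i + t * x i)) \<and>
          (\<lambda>i. y i + - t * x i) \<in> ?K \<and> (\<lambda>i. h i + t * x i) \<in> ?H" by (intro conjI)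
      then show "u \<in> {(\<lambda>i. y i + z i) |y z. y \<in> ?K \<and> z \<in> ?H}"
        by (intro CollectI exI)
    qed
    ultimately show ?thesis unfolding full_subgroup_def \<phi>_def by blast
  qed
qed

text \<open>Starting from \<open>Zn n\<close>, each \<open>w\<close> cuts out the kernel of one more
  functional, and \<open>full_subgroup_kernel\<close> preserves fullness.\<close>

lemma full_subgroup_annihilator:
  assumes "finite W"
  shows "full_subgroup n {v \<in> Zn n. \<forall>w\<in>W. (\<Sum>j<n. v j * w j) = (0::int)}"
  using assms
proof (induction W)
  case empty
  then show ?case by (simp add: full_subgroup_Zn)
next
  case (insert w W)
  have "{v \<in> Zn n. \<forall>u\<in>insert w W. (\<Sum>j<n. v j * u j) = 0} =
    {v \<in> {v \<in> Zn n. \<forall>u\<in>W. (\<Sum>j<n. v j * u j) = 0}. (\<Sum>j<n. v j * w j) = 0}" by auto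
  then show ?case using full_subgroup_kernel[OF insert.IH] by simp
qed

section \<open>Comparison of Betti numbers and the finite family of subgroups\<close>

text \<open>By rank-nullity \<open>hdim\<close> is \<open>c k\<close> minus two ranks. Truncated
  subtraction is antitone in each of them, and both ranks can only drop from \<open>g\<close> to
  \<open>h\<close>.\<close>

lemma hdim_map_mat_mono:
  fixes g :: "'a::comm_ring_1 \<Rightarrow> 'b::field" and h :: "'a \<Rightarrow> 'c::field"
  assumes hom: "comm_ring_hom g" "comm_ring_hom h"
    and D: "D k \<in> carrier_mat r (c k)" "D (k + 1) \<in> carrier_mat (c k) (c (k + 1))"
    and ker: "\<And>f. \<lbrakk>f \<in> minors (D k) \<union> minors (D (k + 1)); g f = 0\<rbrakk> \<Longrightarrow> h f = 0"
  shows "hdim c (\<lambda>j. map_mat g (D j)) k \<le> hdim c (\<lambda>j. map_mat h (D j)) k"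
proof -
  have "vec_space.rank r (map_mat h (D k)) \<le> vec_space.rank r (map_mat g (D k))"
    using hom D(1) ker by (intro rank_map_mat_mono) auto
  moreover have "vec_space.rank (c k) (map_mat h (D (k + 1))) \<le> vec_space.rank (c k) (map_mat g (D (k + 1)))"
    using hom D(2) ker by (intro rank_map_mat_mono) auto
  ultimately show ?thesis
    using D(1) unfolding hdim_def by (subst (1 2) rank_nullity_mat[of _ r "c k"]) auto
qed

theorem theorem7p3:
  fixes n k q :: nat and c :: "nat \<Rightarrow> nat" and d :: "nat \<Rightarrow> 'a::idom laurent mat"
  assumes "fin_free_complex n c d" and "q > 0"
  shows "\<exists>Gs. finite Gs \<and> (\<forall>G\<in>Gs. full_subgroup n G \<and> G \<noteq> Zn n) \<and>
    (\<forall>m P. betti_p n c d k m P \<ge> betti c d k + q \<longleftrightarrow> (\<exists>G\<in>Gs. sqsub P n m G))"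
proof -
  let ?A = "bdry c d k" and ?B = "bdry c d (k + 1)"
  \<comment> \<open>The row count of \<open>?A\<close>; in degree 0 the boundary is the matrix with
    no rows.\<close>
  define r where "r = (if k = 0 then 0 else c (k - 1))"
  have d: "d j \<in> carrier_mat (c (j - 1)) (c j)" "\<And>i l. \<lbrakk>i < c (j - 1); l < c j\<rbrakk> \<Longrightarrow> in_L n (d j $$ (i, l))"
    if "j \<ge> 1" for j
    using assms(1) that unfolding fin_free_complex_def by blast+
  have A: "?A \<in> carrier_mat r (c k)" "\<And>i l. \<lbrakk>i < r; l < c k\<rbrakk> \<Longrightarrow> in_L n (?A $$ (i, l))"
    using d[of k] by (auto simp: bdry_def r_def)
  have B: "?B \<in> carrier_mat (c k) (c (k + 1))" "\<And>i l. \<lbrakk>i < c k; l < c (k + 1)\<rbrakk> \<Longrightarrow> in_L n (?B $$ (i, l))"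
    using d[of "k + 1"] by (auto simp: bdry_def)
  define F where "F = minors ?A \<union> minors ?B"
  define S where "S = (\<Union>f\<in>F. Poly_Mapping.keys f)"
  have finS: "finite S" by (simp add: S_def F_def finite_minors)
  \<comment> \<open>Minors stay in \<open>L\<^sub>n\<close>, so exponents in \<open>S\<close> are
    determined by their first \<open>n\<close> coordinates.\<close>
  have S_low: "Poly_Mapping.lookup a i = 0" if "a \<in> S" "n \<le> i" for a i
    using that in_L_minors[OF A] in_L_minors[OF B] by (fastforce simp: S_def F_def in_L_def)
  \<comment> \<open>\<open>rel m P\<close> records the pairs in \<open>S\<close> identified by
    \<open>P\<close>; \<open>ann E\<close> consists of the functionals vanishing on all differences
    \<open>a - b\<close> with \<open>(a, b)\<close> in \<open>E\<close>.\<close>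
  define rel where "rel m P = {(a, b) \<in> S \<times> S. hom_exp P n m a = hom_exp P n m b}" for m P
  define ann where "ann E = {v \<in> Zn n. \<forall>w\<in>(\<lambda>(a, b) j. Poly_Mapping.lookup a j - Poly_Mapping.lookup b j) ` E.
    (\<Sum>j<n. v j * w j) = 0}" for E :: "((nat \<Rightarrow>\<^sub>0 int) \<times> (nat \<Rightarrow>\<^sub>0 int)) set"
  define Gs where "Gs = {ann (rel m P) |m P. betti c d k + q \<le> betti_p n c d k m P}"
  have fin_rel: "finite (rel m P)" for m P
    by (rule finite_subset[of _ "S \<times> S"]) (auto simp: rel_def finS)
  \<comment> \<open>\<open>P\<close> identifies \<open>a\<close> and \<open>b\<close> exactly when
    every coordinate functional of \<open>P\<close> vanishes on \<open>a - b\<close>.\<close>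
  have sqsub_iff: "sqsub P n m (ann E) \<longleftrightarrow> (\<forall>(a, b)\<in>E. hom_exp P n m a = hom_exp P n m b)" for P m E
  proof -
    have "hom_exp P n m a = hom_exp P n m b \<longleftrightarrow>
        (\<forall>i<m. (\<Sum>j<n. P i j * (Poly_Mapping.lookup a j - Poly_Mapping.lookup b j)) = 0)" for a b
      by (auto simp: poly_mapping_eq_iff fun_eq_iff lookup_hom_exp right_diff_distrib sum_subtractf)
    moreover have "coord P n i \<in> ann E \<longleftrightarrow>
        (\<forall>(a, b)\<in>E. (\<Sum>j<n. P i j * (Poly_Mapping.lookup a j - Poly_Mapping.lookup b j)) = 0)" for i
      by (simp add: ann_def coord_def Zn_def case_prod_unfold)
    ultimately show ?thesis by (auto simp: sqsub_def)
  qed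
  have hom: "comm_ring_hom (\<lambda>f :: 'a laurent. Fract (hom_ring P n m f) 1)" for P m
    by (intro comm_ring_hom_Fract comm_ring_hom_hom_ring)
  have hom': "comm_ring_hom (\<lambda>f :: 'a laurent. Fract f 1)"
    by (rule comm_ring_hom_Fract) (unfold_locales, simp_all)
  have Fract_0: "Fract x 1 = 0 \<longleftrightarrow> x = 0" for x :: "'a laurent"
    by (simp add: Zero_fract_def eq_fract)
  have "finite Gs"
  proof (rule finite_subset)
    \<comment> \<open>Although \<open>m\<close> and \<open>P\<close> range over infinitely many
      values, only the relation on the finite set \<open>S\<close> matters.\<close>
    show "Gs \<subseteq> ann ` Pow (S \<times> S)" by (auto simp: Gs_def rel_def)
  qed (simp add: finS)
  moreover have "full_subgroup n G" if G: "G \<in> Gs" for G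
  proof -
    obtain m P where "G = ann (rel m P)" using G by (auto simp: Gs_def)
    then show ?thesis
      unfolding ann_def using fin_rel by (auto simp only: intro: full_subgroup_annihilator finite_imageI)
  qed
  moreover have "G \<noteq> Zn n" if G: "G \<in> Gs" for G
  proof
    assume GZ: "G = Zn n"
    obtain m P where P: "G = ann (rel m P)" "betti c d k + q \<le> betti_p n c d k m P"
      using G by (auto simp: Gs_def)
    have inj: "a = b" if ab: "a \<in> S" "b \<in> S" "hom_exp P n m a = hom_exp P n m b" for a b
    proof (rule poly_mapping_eqI)
      fix i
      show "Poly_Mapping.lookup a i = Poly_Mapping.lookup b i"
      proof (cases "i < n")
        case True
        \<comment> \<open>The coordinate functional at \<open>i\<close> lies in \<open>Zn n\<close>,
          hence in the annihilator, and so cannot separate \<open>a\<close> from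
          \<open>b\<close>.\<close>
        then have "(\<lambda>j. if j = i then 1 else 0) \<in> ann (rel m P)"
          using GZ P(1) by (auto simp: Zn_def)
        then have "(\<Sum>j<n. (if j = i then 1 else 0) * (Poly_Mapping.lookup a j - Poly_Mapping.lookup b j)) = 0"
          using ab by (auto simp: ann_def rel_def)
        with True show ?thesis by (simp add: if_distrib[of "\<lambda>x. x * _"] cong: if_cong)
      qed (simp add: S_low ab)
    qed
    have "betti_p n c d k m P \<le> betti c d k"
      unfolding betti_p_def betti_def
    proof (rule hdim_map_mat_mono[OF hom hom' A(1) B(1)])
      fix f assume f: "f \<in> minors ?A \<union> minors ?B" "Fract (hom_ring P n m f) 1 = 0"
      \<comment> \<open>As \<open>P\<close> is injective on \<open>S\<close>, the identity factors
        through it on the keys of \<open>f\<close>: a minor killed by \<open>P\<close> was already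
        0.\<close>
      have "push_exp (\<lambda>a. a) f = 0"
        by (rule push_exp_eq_0_mono[of "hom_exp P n m"])
          (use f inj in \<open>auto simp: Fract_0 hom_ring_eq_push_exp S_def F_def\<close>)
      then show "Fract f 1 = 0" by (simp add: push_exp_id Fract_0)
    qed
    with P(2) assms(2) show False by simp
  qed
  moreover have "betti c d k + q \<le> betti_p n c d k m P \<longleftrightarrow> (\<exists>G\<in>Gs. sqsub P n m G)" for m P
  proof
    assume "betti c d k + q \<le> betti_p n c d k m P"
    then have "ann (rel m P) \<in> Gs" by (auto simp: Gs_def)
    moreover have "sqsub P n m (ann (rel m P))" by (auto simp: sqsub_iff rel_def)
    ultimately show "\<exists>G\<in>Gs. sqsub P n m G" by blast
  next
    assume "\<exists>G\<in>Gs. sqsub P n m G"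
    then obtain m' P' where P': "betti c d k + q \<le> betti_p n c d k m' P'" "sqsub P n m (ann (rel m' P'))"
      by (auto simp: Gs_def)
    \<comment> \<open>\<open>P\<close> identifies every pair in \<open>S\<close> that
      \<open>P'\<close> identifies, so it kills every minor that \<open>P'\<close> kills. The target
      ranks \<open>m\<close> and \<open>m'\<close> may differ.\<close>
    have "betti_p n c d k m' P' \<le> betti_p n c d k m P"
      unfolding betti_p_def
    proof (rule hdim_map_mat_mono[OF hom hom A(1) B(1)])
      fix f assume f: "f \<in> minors ?A \<union> minors ?B" "Fract (hom_ring P' n m' f) 1 = 0"
      have "push_exp (hom_exp P n m) f = 0"
        by (rule push_exp_eq_0_mono[of "hom_exp P' n m'"])
          (use f P'(2) in \<open>auto simp: Fract_0 hom_ring_eq_push_exp sqsub_iff rel_def S_def F_def\<close>)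
      then show "Fract (hom_ring P n m f) 1 = 0" by (simp add: Fract_0 hom_ring_eq_push_exp)
    qed
    with P'(1) show "betti c d k + q \<le> betti_p n c d k m P" by simp
  qed
  ultimately show ?thesis by (intro exI[of _ Gs]) blast
qed

end
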